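(* Let $T>0$, $\Omega=\,]0,T[$, $m>0$, $\gamma>0$, $\lambda_d>0$, $H\geqslant 1$. Consider the dynamics with friction model, given for $u\in C^2([0,T],\mathbb{R})$ and $x\in\Omega$ by $\mathscr{F}(u,x)=m\,u''(x)+\gamma\,u'(x)$. Let $(X_1,Y_1),\ldots,(X_n,Y_n)\in\Omega\times\mathbb{R}$ be the observations, and assume that there are two observations such that $Y_i\neq Y_j$. Then, whenever $D\geqslant n-1$, for any integer $n_r\geqslant 1$ and for all $X^{(r)}_1,\ldots,X^{(r)}_{n_r}\in\Omega$, there exists a minimizing sequence $(u_{\hat\theta(p,n_r,D)})_{p\in\mathbb{N}}\in \mathrm{NN}_H(D)^{\mathbb{N}}$ of the empirical risk $$R_{n,n_r}(u_\theta)=\frac{\lambda_d}{n}\sum_{i=1}^n|u_\theta(X_i)-Y_i|^2+\frac1{n_r}\sum_{\ell=1}^{n_r}\mathscr{F}(u_\theta,X^{(r)}_\ell)^2$$ over $\mathrm{NN}_H(D)$ such that $$\lim_{p\to\infty}R_{n,n_r}(u_{\hat\theta(p,n_r,D)})=0\qquad\text{but}\qquad \lim_{p\to\infty}\mathscr{R}_n(u_{\hat\theta(p,n_r,D)})=\infty,$$ where the theoretical risk is $$\mathscr{R}_n(u)=\frac{\lambda_d}{n}\sum_{i=1}^n|u(X_i)-Y_i|^2+\frac1T\int_0^T\mathscr{F}(u,x)^2\,dx .$$ So, this PINN (physics-informed neural network) estimator is not consistent.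
   Context: Observations. The pairs $(X_1,Y_1),\ldots,(X_n,Y_n)$ are i.i.d. copies of a pair $(X,Y)\in\Omega\times\mathbb{R}$ of unknown distribution, with $Y=u^\star(X)+\varepsilon$ and $\mathbb{E}(\varepsilon\mid X)=0$. Here $u^\star$ is the unknown trajectory to be reconstructed; the physical model is perfect, i.e. $\mathscr{F}(u^\star,\cdot)=0$, but the boundary conditions are unknown. Neural networks. For $H\geqslant1$ hidden layers of common width $D\geqslant 1$, and input/output dimensions $d_1,d_2$ (here $d_1=d_2=1$), $u_\theta=\mathcal{A}_{H+1}\circ(\tanh\circ\mathcal{A}_H)\circ\cdots\circ(\tanh\circ\mathcal{A}_1)$, where $\tanh$ is applied element-wise, $\mathcal{A}_k(x)=W_kx+b_k$ with $W_k\in\mathbb{R}^{L_k\times L_{k-1}}$, $b_k\in\mathbb{R}^{L_k}$, $L_0=d_1$, $L_1=\cdots=L_H=D$, $L_{H+1}=d_2$. The parameter is $\theta=(W_1,b_1,\ldots,W_{H+1},b_{H+1})$, $\Theta_{H,D}$ is the set of all such parameters, and $\mathrm{NN}_H(D)=\{u_\theta:\theta\in\Theta_{H,D}\}$. A minimizing sequence of $R_{n,n_r}$ over $\mathrm{NN}_H(D)$ is a sequence in $\mathrm{NN}_H(D)$ whose risks converge to $\inf_{\theta\in\Theta_{H,D}}R_{n,n_r}(u_\theta)$. Consistency here means risk-consistency: $\lim_{n_r\to\infty}\lim_{p\to\infty}\mathscr{R}_n(u_{\hat\theta(p,n_r,D)})=\inf_{u\in\mathrm{NN}_H(D)}\m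athscr{R}_n(u)$.
   Formalization: The formal statement also assumes that X_i = X_j implies Y_i = Y_j; without this the empirical risk is bounded below by a positive constant, so it cannot tend to 0 and the claim fails. *)

theory Defs
  imports "HOL-Analysis.Analysis" "Jordan_Normal_Form.Matrix"
begin

section \<open>Feedforward tanh networks\<close>

type_synonym nn_param = "(real mat \<times> real vec) list"

definition layer_width :: "nat \<Rightarrow> nat \<Rightarrow> nat \<Rightarrow> nat \<Rightarrow> nat \<Rightarrow> nat" where
  "layer_width d1 d2 H D k = (if k = 0 then d1 else if k \<le> H then D else d2)"

text \<open>Position \<open>k\<close> of the list, counted from 0, holds the pair \<open>(W, b)\<close> of the affine map
  number \<open>k + 1\<close>.\<close>

definition nn_params :: "nat \<Rightarrow> nat \<Rightarrow> nat \<Rightarrow> nat \<Rightarrow> nn_param set" where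
  "nn_params d1 d2 H D =
     {\<theta>. length \<theta> = H + 1 \<and>
        (\<forall>k\<le>H. fst (\<theta> ! k) \<in> carrier_mat (layer_width d1 d2 H D (k + 1)) (layer_width d1 d2 H D k) \<and>
               snd (\<theta> ! k) \<in> carrier_vec (layer_width d1 d2 H D (k + 1)))}"

definition affine_layer :: "real mat \<times> real vec \<Rightarrow> real vec \<Rightarrow> real vec" where
  "affine_layer A x = fst A *\<^sub>v x + snd A"

definition tanh_layer :: "real mat \<times> real vec \<Rightarrow> real vec \<Rightarrow> real vec" where
  "tanh_layer A x = map_vec tanh (affine_layer A x)"

definition nn_eval :: "nn_param \<Rightarrow> real vec \<Rightarrow> real vec" where
  "nn_eval \<theta> x = affine_layer (last \<theta>) (fold tanh_layer (butlast \<theta>) x)"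

text \<open>The case of input and output dimension 1, with \<open>\<real>\<^sup>1\<close> identified with \<open>\<real>\<close>.\<close>

definition scalar_nn :: "nn_param \<Rightarrow> real \<Rightarrow> real" where
  "scalar_nn \<theta> x = vec_index (nn_eval \<theta> (vec_of_list [x])) 0"

definition NN :: "nat \<Rightarrow> nat \<Rightarrow> (real \<Rightarrow> real) set" where
  "NN H D = scalar_nn ` nn_params 1 1 H D"

section \<open>Dynamics with friction and risks\<close>

text \<open>This is meant for \<open>x\<close> in the open interval \<open>]0,T[\<close>, where the two-sided derivatives only
  depend on the restriction of \<open>u\<close> to \<open>[0,T]\<close>.\<close>

definition friction :: "real \<Rightarrow> real \<Rightarrow> (real \<Rightarrow> real) \<Rightarrow> real \<Rightarrow> real" where
  "friction m \<gamma> u x = m * deriv (deriv u) x + \<gamma> * deriv u x"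

definition data_fit :: "real \<Rightarrow> nat \<Rightarrow> (nat \<Rightarrow> real) \<Rightarrow> (nat \<Rightarrow> real) \<Rightarrow> (real \<Rightarrow> real) \<Rightarrow> real" where
  "data_fit lam n X Y u = lam / real n * (\<Sum>i=1..n. \<bar>u (X i) - Y i\<bar>\<^sup>2)"

definition empirical_risk ::
  "real \<Rightarrow> real \<Rightarrow> real \<Rightarrow> nat \<Rightarrow> (nat \<Rightarrow> real) \<Rightarrow> (nat \<Rightarrow> real) \<Rightarrow> nat \<Rightarrow> (nat \<Rightarrow> real) \<Rightarrow>
   (real \<Rightarrow> real) \<Rightarrow> real" where
  "empirical_risk m \<gamma> lam n X Y nr Xr u =
     data_fit lam n X Y u + 1 / real nr * (\<Sum>l=1..nr. (friction m \<gamma> u (Xr l))\<^sup>2)"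

definition theoretical_risk ::
  "real \<Rightarrow> real \<Rightarrow> real \<Rightarrow> real \<Rightarrow> nat \<Rightarrow> (nat \<Rightarrow> real) \<Rightarrow> (nat \<Rightarrow> real) \<Rightarrow> (real \<Rightarrow> real) \<Rightarrow> real" where
  "theoretical_risk T m \<gamma> lam n X Y u =
     data_fit lam n X Y u + 1 / T * integral {0<..<T} (\<lambda>x. (friction m \<gamma> u x)\<^sup>2)"

section \<open>Minimizing sequences and consistency\<close>

definition minimizing_sequence ::
  "(real \<Rightarrow> real) set \<Rightarrow> ((real \<Rightarrow> real) \<Rightarrow> real) \<Rightarrow> (nat \<Rightarrow> real \<Rightarrow> real) \<Rightarrow> bool" where
  "minimizing_sequence U R v \<longleftrightarrow>
     (\<forall>p. v p \<in> U) \<and> (\<lambda>p. R (v p)) \<longlonglongrightarrow> (INF w\<in>U. R w)"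

text \<open>\<open>v nr p\<close> is the estimator after \<open>p\<close> steps with \<open>nr\<close> collocation points. The limits
  are taken in the extended reals, so that an infinite inner limit is admissible; they need only
  exist for all sufficiently large \<open>nr\<close>.\<close>

definition risk_consistent ::
  "(real \<Rightarrow> real) set \<Rightarrow> ((real \<Rightarrow> real) \<Rightarrow> real) \<Rightarrow> (nat \<Rightarrow> nat \<Rightarrow> real \<Rightarrow> real) \<Rightarrow> bool" where
  "risk_consistent U R v \<longleftrightarrow>
     (\<exists>L :: nat \<Rightarrow> ereal.
        (\<forall>\<^sub>F nr in sequentially. (\<lambda>p. ereal (R (v nr p))) \<longlonglongrightarrow> L nr) \<and>
        L \<longlonglongrightarrow> ereal (INF w\<in>U. R w))"

end

theory Submission
  imports Defs "HOL-Real_Asymp.Real_Asymp"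
begin

text \<open>The empirical risk sees the differential operator only at finitely many collocation points,
  so it is blind to a very steep step between two of them. Choose a threshold \<open>t\<^sub>k\<close> strictly between
  each pair of consecutive distinct observation points, away from the collocation points, and
  let \<open>u\<^sub>p\<close> be a sum of smooth steps \<open>c\<^sub>k * g (p * (x - t\<^sub>k))\<close>, where \<open>g\<close> is the \<open>H\<close>-fold
  iterate of the hyperbolic tangent. There are at most \<open>n - 1\<close> thresholds, hence \<open>n - 1\<close> neurons
  per layer suffice: the first layer computes \<open>tanh (p * (x - t\<^sub>k))\<close>, the other hidden layers carry
  the identity matrix and only iterate \<open>tanh\<close>, and the output layer sums
  (\<open>tanh_superposition_in_NN\<close>).

  As \<open>p\<close> grows, \<open>u\<^sub>p\<close> tends to a step function; the \<open>c\<^sub>k\<close> are chosen such that this step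
  function interpolates the data. The first two derivatives of \<open>g\<close> are dominated by
  \<open>sech\<^sup>2\<close> (\<open>tanh_iterate_derivatives\<close>), so off the thresholds the derivatives of \<open>u\<^sub>p\<close> vanish in the
  limit in spite of the factors \<open>p\<close> and \<open>p\<^sup>2\<close>. Therefore the empirical risk tends to 0, which is
  its infimum.

  At a threshold with \<open>c\<^sub>k \<noteq> 0\<close>, however, the slope of \<open>u\<^sub>p\<close> grows like \<open>c\<^sub>k * p\<close>, while at the
  observation point to its left the slope vanishes in the limit. The integral of \<open>m u'' + \<gamma> u'\<close> between
  these two points is \<open>m\<close> times the increment of \<open>u'\<close> plus \<open>\<gamma>\<close> times the increment of \<open>u\<close>,
  hence it diverges, and then so does the integral of the square
  (\<open>friction_energy_lower_bound\<close>). The inner limit in the definition of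
  risk consistency is thus infinite for every number of collocation points, which is
  incompatible with a finite outer limit.\<close>

section \<open>Iterated hyperbolic tangents\<close>

lemma tanh_iterate_pos:
  fixes x :: real
  assumes "x > 0"
  shows "(tanh ^^ h) x > 0"
  using assms by (induction h) auto

lemma tanh_iterate_minus: "(tanh ^^ h) (- x :: real) = - (tanh ^^ h) x"
  by (induction h) auto

lemma tanh_iterate_0: "(tanh ^^ h) (0 :: real) = 0"
  by (induction h) auto

lemma isCont_tanh_iterate: "isCont (tanh ^^ h) (x :: real)"
  by (induction h) (auto intro!: isCont_o2 continuous_intros simp: o_def)

lemma tendsto_tanh_iterate_scaled:
  fixes d :: real
  assumes "d \<noteq> 0"
  shows "(\<lambda>p. (tanh ^^ Suc h) (real p * d)) \<longlonglongrightarrow> sgn d * (tanh ^^ h) 1"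
proof -
  have pos: "(\<lambda>p. (tanh ^^ Suc h) (real p * e)) \<longlonglongrightarrow> (tanh ^^ h) 1" if "e > 0" for e :: real
  proof -
    have "filterlim (\<lambda>p. real p * e) at_top sequentially"
      using that by real_asymp
    then have "(\<lambda>p. tanh (real p * e)) \<longlonglongrightarrow> 1"
      using filterlim_compose[OF tanh_real_at_top] by blast
    then show ?thesis
      unfolding funpow_Suc_right o_def
      by (rule isCont_tendsto_compose[OF isCont_tanh_iterate])
  qed
  show ?thesis
  proof (cases "d > 0")
    case True
    with pos show ?thesis by simp
  next
    case False
    with assms have "- d > 0" by simp
    from tendsto_minus[OF pos[OF this]] False assms show ?thesis
      by (simp add: tanh_iterate_minus del: funpow.simps)
  qed
qed

text \<open>By the chain rule, one more \<open>tanh\<close> multiplies the first derivative by \<open>1 - tanh\<^sup>2\<close> of something,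
  a factor in \<open>[0,1]\<close>; so the bound by \<open>sech\<^sup>2 = 1 - tanh\<^sup>2\<close> on \<open>g1\<close> is preserved, as is the slope 1
  at 0. In the second derivative, the new term \<open>- 2 tanh (g) (1 - tanh\<^sup>2 (g)) g1\<^sup>2\<close> is at
  most \<open>2 sech\<^sup>2\<close>, so the constant \<open>C\<close> grows by 2 with each layer.\<close>

lemma tanh_iterate_derivatives:
  "\<exists>g1 g2 C. (\<forall>x :: real. ((tanh ^^ Suc h) has_real_derivative g1 x) (at x)) \<and>
     (\<forall>x. (g1 has_real_derivative g2 x) (at x)) \<and> continuous_on UNIV g2 \<and> g1 0 = 1 \<and>
     (\<forall>x. \<bar>g1 x\<bar> \<le> 1 - (tanh x)\<^sup>2) \<and> (\<forall>x. \<bar>g2 x\<bar> \<le> C * (1 - (tanh x)\<^sup>2)) \<and> C \<ge> 0"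
proof (induction h)
  case 0
  let ?g1 = "\<lambda>x :: real. 1 - (tanh x)\<^sup>2"
  let ?g2 = "\<lambda>x :: real. - 2 * tanh x * (1 - (tanh x)\<^sup>2)"
  have sq: "(tanh x)\<^sup>2 \<le> 1" for x :: real
    using tanh_real_bounds[of x] by (simp add: abs_square_le_1 abs_if)
  have "(tanh ^^ Suc 0 has_real_derivative ?g1 x) (at x)" for x
    by (auto intro!: derivative_eq_intros)
  moreover have "(?g1 has_real_derivative ?g2 x) (at x)" for x
    by (auto intro!: derivative_eq_intros)
  moreover have "continuous_on UNIV ?g2"
    by (auto intro!: continuous_intros)
  moreover have "\<bar>?g1 x\<bar> \<le> 1 - (tanh x)\<^sup>2" for x :: real
    using sq[of x] by simp
  moreover have "\<bar>?g2 x\<bar> \<le> 2 * (1 - (tanh x)\<^sup>2)" for x :: real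
  proof -
    have "\<bar>?g2 x\<bar> = (2 * \<bar>tanh x\<bar>) * (1 - (tanh x)\<^sup>2)"
      using sq[of x] by (simp add: abs_mult)
    also have "\<dots> \<le> 2 * (1 - (tanh x)\<^sup>2)"
      using sq[of x] tanh_real_bounds[of x] by (intro mult_right_mono) auto
    finally show ?thesis .
  qed
  ultimately show ?case
    by (intro exI[of _ ?g1] exI[of _ ?g2] exI[of _ 2]) auto
next
  case (Suc h)
  then obtain g1 g2 :: "real \<Rightarrow> real" and C :: real where
    d1: "\<And>x. ((tanh ^^ Suc h) has_real_derivative g1 x) (at x)" and
    d2: "\<And>x. (g1 has_real_derivative g2 x) (at x)" and
    cont: "continuous_on UNIV g2" and g10: "g1 0 = 1" and
    b1: "\<And>x. \<bar>g1 x\<bar> \<le> 1 - (tanh x)\<^sup>2" and b2: "\<And>x. \<bar>g2 x\<bar> \<le> C * (1 - (tanh x)\<^sup>2)" and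
    C: "C \<ge> 0"
    by blast
  define g where "g = ((tanh :: real \<Rightarrow> real) ^^ Suc h)"
  let ?s = "\<lambda>x :: real. 1 - (tanh x)\<^sup>2"
  have gS: "tanh ^^ Suc (Suc h) = (\<lambda>x :: real. tanh (g x))"
    by (simp add: g_def fun_eq_iff)
  note d1 = d1[folded g_def]
  have s_nonneg: "0 \<le> ?s x" and s_le: "?s x \<le> 1" for x
    using tanh_real_bounds[of x] by (auto simp: abs_square_le_1 abs_if)
  let ?k1 = "\<lambda>x. ?s (g x) * g1 x"
  let ?k2 = "\<lambda>x. - 2 * tanh (g x) * ?s (g x) * (g1 x)\<^sup>2 + ?s (g x) * g2 x"
  have "(tanh ^^ Suc (Suc h) has_real_derivative ?k1 x) (at x)" for x
    unfolding gS by (auto intro!: derivative_eq_intros d1)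
  moreover have "(?k1 has_real_derivative ?k2 x) (at x)" for x
    by (auto intro!: derivative_eq_intros d1 d2 simp: power2_eq_square algebra_simps)
  moreover have "continuous_on UNIV ?k2"
  proof -
    have "continuous_on UNIV g" "continuous_on UNIV g1"
      using d1 d2 by (auto intro: DERIV_continuous_on)
    with cont show ?thesis by (auto intro!: continuous_intros)
  qed
  moreover have "?k1 0 = 1"
    using g10 tanh_iterate_0[of "Suc h"] by (simp add: g_def)
  moreover have "\<bar>?k1 x\<bar> \<le> ?s x" for x
  proof -
    have "\<bar>?k1 x\<bar> \<le> 1 * ?s x"
      unfolding abs_mult using s_nonneg s_le b1 by (intro mult_mono) auto
    then show ?thesis by simp
  qed
  moreover have "\<bar>?k2 x\<bar> \<le> (2 + C) * ?s x" for x
  proof -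
    have "\<bar>tanh (g x)\<bar> * ?s (g x) \<le> 1 * 1"
      using tanh_real_bounds[of "g x"] s_nonneg s_le by (intro mult_mono) auto
    moreover have "(g1 x)\<^sup>2 \<le> ?s x"
    proof -
      have "\<bar>g1 x\<bar> * \<bar>g1 x\<bar> \<le> ?s x * 1"
        using b1[of x] s_le[of x] s_nonneg[of x] by (intro mult_mono) linarith+
      then show ?thesis by (simp add: power2_eq_square)
    qed
    ultimately have "(\<bar>tanh (g x)\<bar> * ?s (g x)) * (g1 x)\<^sup>2 \<le> (1 * 1) * ?s x"
      by (rule mult_mono) auto
    then have 1: "\<bar>- 2 * tanh (g x) * ?s (g x) * (g1 x)\<^sup>2\<bar> \<le> 2 * ?s x"
      using s_nonneg[of "g x"] by (simp add: abs_mult)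
    have "\<bar>?s (g x) * g2 x\<bar> \<le> 1 * (C * ?s x)"
      unfolding abs_mult using s_nonneg s_le b2 by (intro mult_mono) auto
    with 1 show ?thesis
      unfolding distrib_right by linarith
  qed
  moreover have "2 + C \<ge> 0"
    using C by simp
  ultimately show ?case
    by (intro exI[of _ ?k1] exI[of _ ?k2] exI[of _ "2 + C"] conjI allI) blast+
qed

lemma sech_squared_le: "1 - (tanh x)\<^sup>2 \<le> 4 * exp (- 2 * \<bar>x\<bar>)" for x :: real
proof -
  have c: "cosh x > 0" by (rule cosh_real_pos)
  have "1 - (tanh x)\<^sup>2 = 1 / (cosh x)\<^sup>2"
    using cosh_square_eq[of x] sum_power2_gt_zero_iff[of "sinh x" 1]
    by (simp add: tanh_def power_divide divide_simps)
  also have "\<dots> \<le> 1 / (exp \<bar>x\<bar> / 2)\<^sup>2"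
  proof -
    have "exp \<bar>x\<bar> / 2 \<le> cosh x"
      by (auto simp: cosh_def abs_if)
    then show ?thesis
      using c by (intro divide_left_mono power_mono mult_pos_pos zero_less_power) auto
  qed
  also have "\<dots> = 4 * exp (- 2 * \<bar>x\<bar>)"
    by (simp add: field_simps exp_minus power2_eq_square flip: exp_add)
  finally show ?thesis .
qed

text \<open>Exponential decay beats every power of \<open>p\<close>. Only the exponents 1 and 2 matter below: they are
  the powers of the steepness that differentiation brings out.\<close>

lemma tendsto_scaled_sech_squared_bounded:
  fixes f :: "real \<Rightarrow> real"
  assumes f: "\<And>x. \<bar>f x\<bar> \<le> C * (1 - (tanh x)\<^sup>2)" and C: "C \<ge> 0" and d: "d \<noteq> 0"
  shows "(\<lambda>p. real p ^ j * f (real p * d)) \<longlonglongrightarrow> 0"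
proof (rule tendsto_rabs_zero_cancel, rule tendsto_sandwich)
  show "\<forall>\<^sub>F p in sequentially. 0 \<le> \<bar>real p ^ j * f (real p * d)\<bar>" by simp
  have "\<bar>real p ^ j * f (real p * d)\<bar> \<le> real p ^ j * (C * (4 * exp (- 2 * (real p * \<bar>d\<bar>))))" for p
  proof -
    have "\<bar>f (real p * d)\<bar> \<le> C * (4 * exp (- 2 * \<bar>real p * d\<bar>))"
      using f[of "real p * d"] mult_left_mono[OF sech_squared_le[of "real p * d"] C] by linarith
    then show ?thesis
      by (simp add: abs_mult mult_left_mono)
  qed
  then show "\<forall>\<^sub>F p in sequentially.
      \<bar>real p ^ j * f (real p * d)\<bar> \<le> real p ^ j * (C * (4 * exp (- 2 * (real p * \<bar>d\<bar>))))"
    by simp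
  from d have "\<bar>d\<bar> > 0" by simp
  then show "(\<lambda>p. real p ^ j * (C * (4 * exp (- 2 * (real p * \<bar>d\<bar>))))) \<longlonglongrightarrow> 0"
    by real_asymp
qed simp

section \<open>Sums of iterated hyperbolic tangents as networks\<close>

text \<open>The identity matrices in the hidden layers are what makes the iterate of \<open>tanh\<close> appear:
  depth then only changes the shape of the step. Superfluous neurons get output weight 0.\<close>

lemma tanh_superposition_in_NN:
  assumes "H \<ge> 1" and "M \<le> D"
  shows "(\<lambda>x. c0 + (\<Sum>k<M. c k * (tanh ^^ H) (p * (x - t k)))) \<in> NN H D"
proof -
  from \<open>H \<ge> 1\<close> obtain h where H: "H = Suc h" by (cases H) auto
  define A :: "real mat \<times> real vec" where "A = (mat D 1 (\<lambda>_. p), vec D (\<lambda>k. - p * t k))"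
  define B :: "real mat \<times> real vec" where "B = (1\<^sub>m D, 0\<^sub>v D)"
  define E :: "real mat \<times> real vec" where
    "E = (mat 1 D (\<lambda>(_, k). if k < M then c k else 0), vec 1 (\<lambda>_. c0))"
  define \<theta> where "\<theta> = A # replicate h B @ [E]"
  have nth: "\<theta> ! k = (if k = 0 then A else if k \<le> h then B else E)" if "k \<le> H" for k
    using that H by (cases k) (auto simp: \<theta>_def nth_append)
  have "\<theta> \<in> nn_params 1 1 H D"
    unfolding nn_params_def
    by (auto simp: nth H layer_width_def A_def B_def E_def \<theta>_def[THEN arg_cong[of _ _ length]])
  moreover have "scalar_nn \<theta> x = c0 + (\<Sum>k<M. c k * (tanh ^^ H) (p * (x - t k)))" for x
  proof -
    have B: "tanh_layer B (vec D f) = vec D (\<lambda>k. tanh (f k))" for f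
      by (intro eq_vecI) (auto simp: tanh_layer_def affine_layer_def B_def)
    have Bs: "fold tanh_layer (replicate j B) (vec D f) = vec D (\<lambda>k. (tanh ^^ j) (f k))" for j f
      by (induction j arbitrary: f) (auto simp: B funpow_swap1)
    have A: "tanh_layer A (vec_of_list [x]) = vec D (\<lambda>k. tanh (p * (x - t k)))"
      by (intro eq_vecI) (auto simp: tanh_layer_def affine_layer_def A_def scalar_prod_def algebra_simps)
    have "butlast \<theta> = A # replicate h B" "last \<theta> = E"
      by (simp_all add: \<theta>_def butlast_append)
    moreover have "(tanh ^^ H) z = (tanh ^^ h) (tanh z)" for z :: real
      by (simp add: H funpow_swap1)
    ultimately have "nn_eval \<theta> (vec_of_list [x]) =
        affine_layer E (vec D (\<lambda>k. (tanh ^^ H) (p * (x - t k))))"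
      by (simp add: nn_eval_def A Bs del: vec_of_list_Cons fold_replicate)
    then have "scalar_nn \<theta> x = (\<Sum>k = 0..<D. (if k < M then c k else 0) * (tanh ^^ H) (p * (x - t k))) + c0"
      by (simp add: scalar_nn_def affine_layer_def E_def scalar_prod_def del: vec_of_list_Cons)
    also have "(\<Sum>k = 0..<D. (if k < M then c k else 0) * (tanh ^^ H) (p * (x - t k))) =
        (\<Sum>k<M. c k * (tanh ^^ H) (p * (x - t k)))"
      using \<open>M \<le> D\<close> by (intro sum.mono_neutral_cong_right) auto
    finally show ?thesis by simp
  qed
  ultimately show ?thesis
    unfolding NN_def by (intro image_eqI[of _ _ \<theta>]) auto
qed

section \<open>Thresholds between the observation points\<close>

text \<open>The points of \<open>S\<close> are enumerated in increasing order and one threshold is put in each gap. A gap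
  is an infinite set, so the finitely many points of \<open>B\<close> can be avoided.\<close>

lemma ex_separating_thresholds:
  fixes S B :: "real set"
  assumes "finite S" and "S \<noteq> {}" and "finite B"
  shows "\<exists>x t. S = x ` {..card S - 1} \<and>
     (\<forall>j\<le>card S - 1. \<forall>k<card S - 1. (k < j \<longrightarrow> t k < x j) \<and> (j \<le> k \<longrightarrow> x j < t k)) \<and>
     (\<forall>k<card S - 1. t k \<notin> B)"
proof -
  define M where "M = card S - 1"
  define xs where "xs = sorted_list_of_set S"
  have len: "length xs = Suc M"
    using assms by (simp add: xs_def M_def Suc_diff_le card_gt_0_iff Suc_leI)
  have set: "set xs = S"
    using assms by (simp add: xs_def)
  have mono: "xs ! i < xs ! j" if "i < j" "j \<le> M" for i j
    using that len strict_sorted_list_of_set[of S] by (simp add: xs_def sorted_wrt_nth_less)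
  have le: "xs ! i \<le> xs ! j" if "i \<le> j" "j \<le> M" for i j
    using that mono[of i j] by (cases "i = j") auto
  have "\<exists>s. k < M \<longrightarrow> xs ! k < s \<and> s < xs ! Suc k \<and> s \<notin> B" for k
  proof (cases "k < M")
    case True
    then have "infinite {xs ! k <..< xs ! Suc k}"
      using mono[of k "Suc k"] by (intro infinite_Ioo) auto
    then have "\<not> {xs ! k <..< xs ! Suc k} \<subseteq> B"
      using \<open>finite B\<close> infinite_super by blast
    then show ?thesis by auto
  qed auto
  then obtain t where t: "\<And>k. k < M \<Longrightarrow> xs ! k < t k \<and> t k < xs ! Suc k \<and> t k \<notin> B"
    by metis
  have "S = (\<lambda>j. xs ! j) ` {..M}"
    using len by (auto simp: set[symmetric] set_conv_nth less_Suc_eq_le)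
  moreover have "t k < xs ! j" if "j \<le> M" "k < j" for j k
    using t[of k] le[of "Suc k" j] that by auto
  moreover have "xs ! j < t k" if "j \<le> k" "k < M" for j k
    using t[of k] le[of j k] that by auto
  ultimately show ?thesis
    using t unfolding M_def[symmetric]
    by (intro exI[of _ "\<lambda>j. xs ! j"] exI[of _ t]) auto
qed

lemma sum_increments_below:
  fixes y :: "nat \<Rightarrow> real"
  assumes "j \<le> M"
  shows "(\<Sum>k<M. if k < j then y (Suc k) - y k else 0) = y j - y 0"
proof -
  have "(\<Sum>k<M. if k < j then y (Suc k) - y k else 0) = (\<Sum>k<j. y (Suc k) - y k)"
    using assms by (intro sum.mono_neutral_cong_right) auto
  then show ?thesis by (simp add: sum_lessThan_telescope)
qed

section \<open>A lower bound for the friction energy\<close>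

lemma friction_eq:
  assumes "\<And>x. (u has_real_derivative u1 x) (at x)" and "\<And>x. (u1 has_real_derivative u2 x) (at x)"
  shows "friction m \<gamma> u x = m * u2 x + \<gamma> * u1 x"
proof -
  have "deriv u = u1" "deriv u1 = u2"
    using assms by (auto intro!: ext DERIV_imp_deriv)
  then show ?thesis by (simp add: friction_def)
qed

text \<open>Integrate \<open>f\<^sup>2 \<ge> 2 c f - c\<^sup>2\<close> over \<open>[a,b]\<close>, where \<open>f = m u'' + \<gamma> u'\<close> has an explicit
  antiderivative. This replaces the Cauchy-Schwarz inequality; the free constant \<open>c\<close> allows to
  match the sign of the integral of \<open>f\<close>.\<close>

lemma friction_energy_lower_bound:
  assumes d1: "\<And>x. (u has_real_derivative u1 x) (at x)"
    and d2: "\<And>x. (u1 has_real_derivative u2 x) (at x)"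
    and cont: "continuous_on UNIV u2" and ab: "0 \<le> a" "a \<le> b" "b \<le> T"
  shows "2 * c * (m * (u1 b - u1 a) + \<gamma> * (u b - u a)) - c\<^sup>2 * T
      \<le> integral {0<..<T} (\<lambda>x. (friction m \<gamma> u x)\<^sup>2)"
proof -
  define f where "f = (\<lambda>x. m * u2 x + \<gamma> * u1 x)"
  have fr: "friction m \<gamma> u = f"
    using friction_eq[OF d1 d2] by (auto simp: f_def)
  have "continuous_on UNIV u1"
    using d2 by (auto intro: DERIV_continuous_on)
  with cont have contf: "continuous_on UNIV f"
    unfolding f_def by (auto intro!: continuous_intros)
  have int: "(\<lambda>x. (f x)\<^sup>2) integrable_on {s..r}" for s r
    by (intro integrable_continuous_interval continuous_intros continuous_on_subset[OF contf]) auto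
  have "((\<lambda>x. 2 * c * f x - c\<^sup>2) has_integral
      ((2 * c * (m * u1 b + \<gamma> * u b) - c\<^sup>2 * b) - (2 * c * (m * u1 a + \<gamma> * u a) - c\<^sup>2 * a))) {a..b}"
    unfolding f_def
    by (rule fundamental_theorem_of_calculus[OF \<open>a \<le> b\<close>],
        unfold has_real_derivative_iff_has_vector_derivative[symmetric])
      (auto intro!: derivative_eq_intros has_field_derivative_at_within[OF d1]
        has_field_derivative_at_within[OF d2] simp: algebra_simps)
  moreover have "2 * c * f x - c\<^sup>2 \<le> (f x)\<^sup>2" for x
    using zero_le_power2[of "f x - c"] by (simp add: power2_diff algebra_simps)
  ultimately have "(2 * c * (m * u1 b + \<gamma> * u b) - c\<^sup>2 * b) - (2 * c * (m * u1 a + \<gamma> * u a) - c\<^sup>2 * a)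
      \<le> integral {a..b} (\<lambda>x. (f x)\<^sup>2)"
    by (rule has_integral_le[OF _ integrable_integral[OF int]])
  also have "\<dots> \<le> integral {0..T} (\<lambda>x. (f x)\<^sup>2)"
    using ab int by (intro integral_subset_le) auto
  also have "\<dots> = integral {0<..<T} (\<lambda>x. (f x)\<^sup>2)"
    by (simp add: integral_open_interval_real)
  finally have *: "2 * c * (m * (u1 b - u1 a) + \<gamma> * (u b - u a)) - c\<^sup>2 * (b - a)
      \<le> integral {0<..<T} (\<lambda>x. (f x)\<^sup>2)"
    by (simp add: algebra_simps)
  have "c\<^sup>2 * (b - a) \<le> c\<^sup>2 * T"
    using ab by (intro mult_left_mono) auto
  with * show ?thesis by (simp add: fr)
qed

section \<open>Overfitting networks\<close>

lemma data_fit_nonneg: "lam \<ge> 0 \<Longrightarrow> data_fit lam n X Y w \<ge> 0"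
  unfolding data_fit_def by (intro mult_nonneg_nonneg sum_nonneg) auto

text \<open>The steep interpolating step functions. Two distinct values \<open>Y\<^sub>i\<close> guarantee a step of nonzero
  height, which is where the theoretical risk explodes; that equal inputs carry equal outputs
  is what makes exact interpolation possible in the limit.\<close>

lemma ex_overfitting_networks:
  fixes T m \<gamma> lam :: real and X Y Xr :: "nat \<Rightarrow> real"
  assumes T: "T > 0" and m: "m > 0" and lam: "lam > 0" and H: "H \<ge> 1"
    and X: "\<forall>i\<in>{1..n}. X i \<in> {0<..<T}"
    and XY: "\<forall>i\<in>{1..n}. \<forall>j\<in>{1..n}. X i = X j \<longrightarrow> Y i = Y j"
    and Yne: "\<exists>i\<in>{1..n}. \<exists>j\<in>{1..n}. Y i \<noteq> Y j"
    and D: "D \<ge> n - 1"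
  shows "\<exists>v. (\<forall>p. v p \<in> NN H D) \<and>
    (\<lambda>p. empirical_risk m \<gamma> lam n X Y nr Xr (v p)) \<longlonglongrightarrow> 0 \<and>
    filterlim (\<lambda>p. theoretical_risk T m \<gamma> lam n X Y (v p)) at_top sequentially"
proof -
  from H obtain h where H': "H = Suc h" by (cases H) auto
  define g where "g = ((tanh :: real \<Rightarrow> real) ^^ H)"
  obtain g1 g2 :: "real \<Rightarrow> real" and C :: real where
    d1: "\<And>x. (g has_real_derivative g1 x) (at x)" and
    d2: "\<And>x. (g1 has_real_derivative g2 x) (at x)" and
    cont: "continuous_on UNIV g2" and g10: "g1 0 = 1" and
    b1: "\<And>x. \<bar>g1 x\<bar> \<le> 1 - (tanh x)\<^sup>2" and b2: "\<And>x. \<bar>g2 x\<bar> \<le> C * (1 - (tanh x)\<^sup>2)" and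
    C: "C \<ge> 0"
    using tanh_iterate_derivatives[of h] unfolding g_def H' by metis
  define G :: real where "G = (tanh ^^ h) 1"
  have G: "G > 0" unfolding G_def by (rule tanh_iterate_pos) simp
  have glim: "(\<lambda>p. g (real p * d)) \<longlonglongrightarrow> sgn d * G" if "d \<noteq> 0" for d
    using tendsto_tanh_iterate_scaled[OF that] by (simp add: g_def H' G_def)

  (* Repeated observation points are merged: only the M + 1 distinct ones need separating. *)
  define S where "S = X ` {1..n}"
  define M where "M = card S - 1"
  have S: "finite S" "S \<noteq> {}" using Yne by (auto simp: S_def)
  have "M \<le> D"
    using card_image_le[of "{1..n}" X] D by (simp add: M_def S_def)
  obtain x t where sep: "S = x ` {..M} \<and>
     (\<forall>j\<le>M. \<forall>k<M. (k < j \<longrightarrow> t k < x j) \<and> (j \<le> k \<longrightarrow> x j < t k)) \<and>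
     (\<forall>k<M. t k \<notin> Xr ` {1..nr})"
    using ex_separating_thresholds[OF S, of "Xr ` {1..nr}"] unfolding M_def by blast
  have Sx: "S = x ` {..M}" using sep by blast
  have txj: "t k < x j" if "j \<le> M" "k < j" for j k using sep that by auto
  have xjt: "x j < t k" if "j \<le> k" "k < M" for j k using sep that by auto
  have tXr: "t k \<notin> Xr ` {1..nr}" if "k < M" for k using sep that by blast
  have t_mono: "t k < t l" if "k < l" "l < M" for k l
    using txj[of l k] xjt[of l l] that by auto
  have t_ne: "t l - t k \<noteq> 0" if "k < M" "l < M" "k \<noteq> l" for k l
    using t_mono[of k l] t_mono[of l k] that by (cases k l rule: linorder_cases) auto
  have x_ne: "x j - t k \<noteq> 0" if "j \<le> M" "k < M" for j k
    using txj[of j k] xjt[of j k] that by (cases "k < j") auto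

  define y where "y j = Y (SOME i. i \<in> {1..n} \<and> X i = x j)" for j
  have idx: "\<exists>j\<le>M. X i = x j \<and> Y i = y j" if i: "i \<in> {1..n}" for i
  proof -
    from i have "X i \<in> S" by (simp add: S_def)
    then obtain j where j: "j \<le> M" "X i = x j" by (auto simp: Sx)
    have "(SOME i. i \<in> {1..n} \<and> X i = x j) \<in> {1..n} \<and> X (SOME i. i \<in> {1..n} \<and> X i = x j) = x j"
      by (rule someI[of _ i]) (use i j in auto)
    then have "Y i = y j" using XY i j unfolding y_def by metis
    with j show ?thesis by blast
  qed
  obtain K where K: "K < M" "y (Suc K) \<noteq> y K"
  proof -
    have "\<exists>K<M. y (Suc K) \<noteq> y K"
    proof (rule ccontr)
      assume "\<not> ?thesis"
      then have "y j = y 0" if "j \<le> M" for j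
        using that by (induction j) auto
      with Yne idx show False by metis
    qed
    with that show ?thesis by blast
  qed
  (* The step at t k has total height 2 * c k * G, because g runs from -G to G, and must equal
     y (Suc k) - y k. The offset c0 compensates the value -c k * G that every step takes at the
     leftmost point. *)
  define c where "c k = (y (Suc k) - y k) / (2 * G)" for k
  define c0 where "c0 = y 0 + (\<Sum>k<M. c k * G)"
  have cK: "c K \<noteq> 0" using K G by (simp add: c_def)
  define u where "u p z = c0 + (\<Sum>k<M. c k * g (real p * (z - t k)))" for p :: nat and z
  define u1 where "u1 p z = (\<Sum>k<M. c k * (real p * g1 (real p * (z - t k))))" for p :: nat and z
  define u2 where "u2 p z = (\<Sum>k<M. c k * (real p ^ 2 * g2 (real p * (z - t k))))" for p :: nat and z
  have u_d1: "(u p has_real_derivative u1 p z) (at z)" for p z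
    unfolding u_def u1_def
    by (auto intro!: derivative_eq_intros DERIV_chain'[OF _ d1] simp: mult_ac)
  have u_d2: "(u1 p has_real_derivative u2 p z) (at z)" for p z
    unfolding u1_def u2_def
    by (auto intro!: derivative_eq_intros DERIV_chain'[OF _ d2] simp: mult_ac power2_eq_square)
  have u_cont: "continuous_on UNIV (u2 p)" for p
    unfolding u2_def by (auto intro!: continuous_intros continuous_on_compose2[OF cont])
  have u_NN: "u p \<in> NN H D" for p
    using tanh_superposition_in_NN[OF H \<open>M \<le> D\<close>, of c0 c p t] by (simp add: u_def[abs_def] g_def)

  have u1_lim: "(\<lambda>p. u1 p z) \<longlonglongrightarrow> 0" if "\<And>k. k < M \<Longrightarrow> z - t k \<noteq> 0" for z
    unfolding u1_def
    using tendsto_scaled_sech_squared_bounded[of g1 1 _ 1] b1 that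
    by (intro tendsto_null_sum tendsto_mult_right_zero) auto
  have u2_lim: "(\<lambda>p. u2 p z) \<longlonglongrightarrow> 0" if "\<And>k. k < M \<Longrightarrow> z - t k \<noteq> 0" for z
    unfolding u2_def
    using tendsto_scaled_sech_squared_bounded[OF b2 C] that
    by (intro tendsto_null_sum tendsto_mult_right_zero) auto
  have u_lim: "(\<lambda>p. u p (x j)) \<longlonglongrightarrow> y j" if j: "j \<le> M" for j
  proof -
    have "(\<lambda>p. u p (x j)) \<longlonglongrightarrow> c0 + (\<Sum>k<M. c k * (sgn (x j - t k) * G))"
      unfolding u_def using x_ne[OF j] by (intro tendsto_intros glim) auto
    also have "c0 + (\<Sum>k<M. c k * (sgn (x j - t k) * G))
        = y 0 + (\<Sum>k<M. c k * G + c k * (sgn (x j - t k) * G))"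
      by (simp add: c0_def sum.distrib)
    also have "(\<Sum>k<M. c k * G + c k * (sgn (x j - t k) * G))
        = (\<Sum>k<M. if k < j then y (Suc k) - y k else 0)"
    proof (rule sum.cong)
      fix k assume "k \<in> {..<M}"
      then have "sgn (x j - t k) = (if k < j then 1 else -1)"
        using txj[OF j, of k] xjt[of j k] by auto
      then show "c k * G + c k * (sgn (x j - t k) * G) = (if k < j then y (Suc k) - y k else 0)"
        using G by (simp add: c_def field_simps)
    qed simp
    finally show ?thesis by (simp add: sum_increments_below[OF j])
  qed

  have fit: "(\<lambda>p. data_fit lam n X Y (u p)) \<longlonglongrightarrow> 0"
  proof -
    have "(\<lambda>p. \<bar>u p (X i) - Y i\<bar>\<^sup>2) \<longlonglongrightarrow> 0" if "i \<in> {1..n}" for i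
    proof -
      from idx[OF that] obtain j where "j \<le> M" "X i = x j" "Y i = y j" by blast
      then have "(\<lambda>p. \<bar>u p (X i) - Y i\<bar>\<^sup>2) \<longlonglongrightarrow> \<bar>y j - y j\<bar>\<^sup>2"
        unfolding \<open>X i = x j\<close> \<open>Y i = y j\<close> using \<open>j \<le> M\<close> by (intro tendsto_intros u_lim)
      then show ?thesis by simp
    qed
    then show ?thesis
      unfolding data_fit_def by (intro tendsto_mult_right_zero tendsto_null_sum) auto
  qed
  have emp: "(\<lambda>p. empirical_risk m \<gamma> lam n X Y nr Xr (u p)) \<longlonglongrightarrow> 0"
  proof -
    have "(\<lambda>p. (friction m \<gamma> (u p) (Xr l))\<^sup>2) \<longlonglongrightarrow> 0" if "l \<in> {1..nr}" for l
    proof -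
      have ne: "Xr l - t k \<noteq> 0" if "k < M" for k
        using tXr[OF that] \<open>l \<in> {1..nr}\<close> by (metis image_eqI right_minus_eq)
      have "(\<lambda>p. (m * u2 p (Xr l) + \<gamma> * u1 p (Xr l))\<^sup>2) \<longlonglongrightarrow> (m * 0 + \<gamma> * 0)\<^sup>2"
        by (intro tendsto_intros u1_lim u2_lim ne)
      then show ?thesis by (simp add: friction_eq[OF u_d1 u_d2])
    qed
    then have "(\<lambda>p. 1 / real nr * (\<Sum>l = 1..nr. (friction m \<gamma> (u p) (Xr l))\<^sup>2)) \<longlonglongrightarrow> 0"
      by (intro tendsto_mult_right_zero tendsto_null_sum) auto
    from tendsto_add[OF fit this] show ?thesis by (simp add: empirical_risk_def)
  qed

  (* Between the observation point x K, where the slope vanishes in the limit, and the threshold t K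
     of a genuine step, where it is of order p, the derivative increases without bound. *)
  define a where "a = x K"
  define b where "b = t K"
  have ab: "0 \<le> a" "a \<le> b" "b \<le> T"
  proof -
    have "x K \<in> S" "x (Suc K) \<in> S" using K by (auto simp: Sx)
    then have "x K \<in> {0<..<T}" "x (Suc K) \<in> {0<..<T}" using X by (auto simp: S_def)
    then show "0 \<le> a" "a \<le> b" "b \<le> T"
      using K xjt[of K K] txj[of "Suc K" K] by (auto simp: a_def b_def)
  qed
  have slope: "filterlim (\<lambda>p. c K * u1 p b) at_top sequentially"
  proof -
    (* Only the K-th step contributes at its own threshold, with g1 0 = 1. *)
    have split: "c K * u1 p b = c K * (\<Sum>k\<in>{..<M} - {K}. c k * (real p * g1 (real p * (b - t k))))
        + (c K)\<^sup>2 * real p" for p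
      using K unfolding u1_def
      by (subst sum.remove[of _ K]) (auto simp: b_def g10 power2_eq_square algebra_simps)
    have "(\<lambda>p. c K * (\<Sum>k\<in>{..<M} - {K}. c k * (real p * g1 (real p * (b - t k))))) \<longlonglongrightarrow> 0"
      using tendsto_scaled_sech_squared_bounded[of g1 1 _ 1] b1 t_ne K
      by (intro tendsto_null_sum tendsto_mult_right_zero) (auto simp: b_def)
    moreover have "filterlim (\<lambda>p. (c K)\<^sup>2 * real p) at_top sequentially"
      using cK by (intro filterlim_tendsto_pos_mult_at_top[OF tendsto_const _ filterlim_real_sequentially]) auto
    ultimately show ?thesis
      unfolding split by (rule filterlim_tendsto_add_at_top)
  qed
  obtain l where l: "(\<lambda>p. u p b) \<longlonglongrightarrow> l"
  proof
    show "(\<lambda>p. u p b) \<longlonglongrightarrow> c0 + (\<Sum>k<M. c k * (sgn (b - t k) * G))"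
      unfolding u_def
    proof (intro tendsto_intros)
      fix k assume "k \<in> {..<M}"
      then show "(\<lambda>p. g (real p * (b - t k))) \<longlonglongrightarrow> sgn (b - t k) * G"
        using glim[of "b - t k"] tanh_iterate_0[of H] by (cases "b = t k") (auto simp: g_def)
    qed
  qed
  (* With c = c K in the energy bound, the leading term is 2 * m * (c K)^2 * p, whatever the sign of
     the step. *)
  define low where "low p = 2 * c K * (m * (u1 p b - u1 p a) + \<gamma> * (u p b - u p a)) - (c K)\<^sup>2 * T" for p
  have low: "filterlim low at_top sequentially"
  proof -
    have "(\<lambda>p. 2 * c K * (\<gamma> * (u p b - u p a) - m * u1 p a) - (c K)\<^sup>2 * T)
        \<longlonglongrightarrow> 2 * c K * (\<gamma> * (l - y K) - m * 0) - (c K)\<^sup>2 * T"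
      unfolding a_def using K x_ne by (intro tendsto_intros l u_lim u1_lim) auto
    moreover have "filterlim (\<lambda>p. 2 * m * (c K * u1 p b)) at_top sequentially"
      using m by (intro filterlim_tendsto_pos_mult_at_top[OF tendsto_const _ slope]) auto
    ultimately have "filterlim (\<lambda>p. 2 * c K * (\<gamma> * (u p b - u p a) - m * u1 p a) - (c K)\<^sup>2 * T
        + 2 * m * (c K * u1 p b)) at_top sequentially"
      by (rule filterlim_tendsto_add_at_top)
    then show ?thesis
      by (simp add: low_def[abs_def] algebra_simps)
  qed
  have "filterlim (\<lambda>p. 1 / T * low p) at_top sequentially"
    using T by (intro filterlim_tendsto_pos_mult_at_top[OF tendsto_const _ low]) auto
  then have "filterlim (\<lambda>p. theoretical_risk T m \<gamma> lam n X Y (u p)) at_top sequentially"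
  proof (rule filterlim_at_top_mono, intro always_eventually allI)
    fix p
    have "0 \<le> data_fit lam n X Y (u p)"
      using lam by (intro data_fit_nonneg) simp
    moreover have "1 / T * low p \<le> 1 / T * integral {0<..<T} (\<lambda>z. (friction m \<gamma> (u p) z)\<^sup>2)"
      using T friction_energy_lower_bound[OF u_d1 u_d2 u_cont ab, where c = "c K" and m = m and \<gamma> = \<gamma>]
      unfolding low_def by (intro mult_left_mono) auto
    ultimately show "1 / T * low p \<le> theoretical_risk T m \<gamma> lam n X Y (u p)"
      unfolding theoretical_risk_def by linarith
  qed
  with u_NN emp show ?thesis by blast
qed

section \<open>Inconsistency\<close>

lemma minimizing_sequenceI_tendsto_0:
  assumes nonneg: "\<And>w. 0 \<le> R w" and v: "\<And>p. v p \<in> U" and lim: "(\<lambda>p. R (v p)) \<longlonglongrightarrow> 0"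
  shows "minimizing_sequence U R v"
proof -
  have bdd: "bdd_below (R ` U)" using nonneg by (intro bdd_belowI2)
  have "(INF w\<in>U. R w) \<le> 0"
    using lim by (rule tendsto_lowerbound) (auto intro!: always_eventually cINF_lower bdd v)
  moreover have "0 \<le> (INF w\<in>U. R w)"
    using nonneg v by (intro cINF_greatest) auto
  ultimately show ?thesis
    using v lim by (auto simp: minimizing_sequence_def dest: order.antisym)
qed

text \<open>Limits in the extended reals are unique, so every inner limit is \<open>\<infinity>\<close>, and so is the outer one.\<close>

lemma not_risk_consistent_if_divergent:
  assumes "\<forall>nr\<ge>1. filterlim (\<lambda>p. R (v nr p)) at_top sequentially"
  shows "\<not> risk_consistent U R v"
proof
  assume "risk_consistent U R v"
  then obtain L :: "nat \<Rightarrow> ereal" where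
    L: "\<forall>\<^sub>F nr in sequentially. (\<lambda>p. ereal (R (v nr p))) \<longlonglongrightarrow> L nr" and
    lim: "L \<longlonglongrightarrow> ereal (INF w\<in>U. R w)"
    by (auto simp: risk_consistent_def)
  have "\<forall>\<^sub>F nr in sequentially. L nr = \<infinity>"
    using L eventually_ge_at_top[of 1]
  proof eventually_elim
    case (elim nr)
    then have "(\<lambda>p. ereal (R (v nr p))) \<longlonglongrightarrow> \<infinity>"
      using assms by (simp add: tendsto_PInfty_eq_at_top)
    with elim show ?case by (auto intro: LIMSEQ_unique)
  qed
  then have "L \<longlonglongrightarrow> \<infinity>" by (rule tendsto_eventually)
  with lim have "ereal (INF w\<in>U. R w) = \<infinity>" by (rule LIMSEQ_unique)
  then show False by simp
qed

theorem proposition3p1: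
  fixes T m \<gamma> lam :: real and H D n :: nat and X Y :: "nat \<Rightarrow> real"
  assumes "T > 0" and "m > 0" and "\<gamma> > 0" and "lam > 0" and "H \<ge> 1" and "D \<ge> 1"
    and "\<forall>i\<in>{1..n}. X i \<in> {0<..<T}"
    and "\<forall>i\<in>{1..n}. \<forall>j\<in>{1..n}. X i = X j \<longrightarrow> Y i = Y j"
    and "\<exists>i\<in>{1..n}. \<exists>j\<in>{1..n}. Y i \<noteq> Y j"
    and "D \<ge> n - 1"
  shows "(\<forall>nr\<ge>1. \<forall>Xr :: nat \<Rightarrow> real. (\<forall>l\<in>{1..nr}. Xr l \<in> {0<..<T}) \<longrightarrow>
           (\<exists>v :: nat \<Rightarrow> real \<Rightarrow> real.
              minimizing_sequence (NN H D) (empirical_risk m \<gamma> lam n X Y nr Xr) v \<and>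
              (\<lambda>p. empirical_risk m \<gamma> lam n X Y nr Xr (v p)) \<longlonglongrightarrow> 0 \<and>
              filterlim (\<lambda>p. theoretical_risk T m \<gamma> lam n X Y (v p)) at_top sequentially)) \<and>
         (\<forall>Xr :: nat \<Rightarrow> nat \<Rightarrow> real. (\<forall>nr\<ge>1. \<forall>l\<in>{1..nr}. Xr nr l \<in> {0<..<T}) \<longrightarrow>
           (\<exists>v :: nat \<Rightarrow> nat \<Rightarrow> real \<Rightarrow> real.
              (\<forall>nr\<ge>1.
                 minimizing_sequence (NN H D) (empirical_risk m \<gamma> lam n X Y nr (Xr nr)) (v nr) \<and>
                 (\<lambda>p. empirical_risk m \<gamma> lam n X Y nr (Xr nr) (v nr p)) \<longlonglongrightarrow> 0 \<and>
                 filterlim (\<lambda>p. theoretical_risk T m \<gamma> lam n X Y (v nr p)) at_top sequentially) \<and>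
              \<not> risk_consistent (NN H D) (theoretical_risk T m \<gamma> lam n X Y) v))"
proof -
  have nonneg: "0 \<le> empirical_risk m \<gamma> lam n X Y nr Xr w" for nr Xr w
    using \<open>lam > 0\<close>
    unfolding empirical_risk_def
    by (intro add_nonneg_nonneg mult_nonneg_nonneg sum_nonneg data_fit_nonneg) auto
  have ex: "\<exists>v. minimizing_sequence (NN H D) (empirical_risk m \<gamma> lam n X Y nr Xr) v \<and>
      (\<lambda>p. empirical_risk m \<gamma> lam n X Y nr Xr (v p)) \<longlonglongrightarrow> 0 \<and>
      filterlim (\<lambda>p. theoretical_risk T m \<gamma> lam n X Y (v p)) at_top sequentially" for nr Xr
    using ex_overfitting_networks[of T m lam H n X Y D \<gamma> nr Xr] assms
      minimizing_sequenceI_tendsto_0[of "empirical_risk m \<gamma> lam n X Y nr Xr", OF nonneg]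
    by metis
  show ?thesis
  proof (intro conjI allI impI)
    fix Xr :: "nat \<Rightarrow> nat \<Rightarrow> real"
    from ex have "\<forall>nr. \<exists>w.
        minimizing_sequence (NN H D) (empirical_risk m \<gamma> lam n X Y nr (Xr nr)) w \<and>
        (\<lambda>p. empirical_risk m \<gamma> lam n X Y nr (Xr nr) (w p)) \<longlonglongrightarrow> 0 \<and>
        filterlim (\<lambda>p. theoretical_risk T m \<gamma> lam n X Y (w p)) at_top sequentially"
      by (intro allI)
    from choice[OF this] obtain v where v: "\<And>nr.
        minimizing_sequence (NN H D) (empirical_risk m \<gamma> lam n X Y nr (Xr nr)) (v nr) \<and>
        (\<lambda>p. empirical_risk m \<gamma> lam n X Y nr (Xr nr) (v nr p)) \<longlonglongrightarrow> 0 \<and>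
        filterlim (\<lambda>p. theoretical_risk T m \<gamma> lam n X Y (v nr p)) at_top sequentially"
      by blast
    show "\<exists>v. (\<forall>nr\<ge>1.
        minimizing_sequence (NN H D) (empirical_risk m \<gamma> lam n X Y nr (Xr nr)) (v nr) \<and>
        (\<lambda>p. empirical_risk m \<gamma> lam n X Y nr (Xr nr) (v nr p)) \<longlonglongrightarrow> 0 \<and>
        filterlim (\<lambda>p. theoretical_risk T m \<gamma> lam n X Y (v nr p)) at_top sequentially) \<and>
        \<not> risk_consistent (NN H D) (theoretical_risk T m \<gamma> lam n X Y) v"
      using v by (intro exI[of _ v] conjI not_risk_consistent_if_divergent allI impI) blast+
  qed (rule ex)
qed

end
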